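(* Let $A$ be an $n$-by-$m$ matrix with $n\ge m$, whose rows are (without loss of generality) already in the correct pivot order. If $L$ in the output of $[L,U]=LUR(A)$, computed in floating point arithmetic, is sufficiently well conditioned, then $L\cdot U=A+\delta A$ where $\|\delta A\|=O(\varepsilon)\|A\|$. Here $O(\cdot)$ absorbs all factors depending on $\|L\|$, $\|L^{-1}\|$, and $n$.
   Context: Arithmetic is floating point with machine epsilon $\varepsilon$; matrix products are computed by a stable matrix multiplication algorithm: the computed product of $n$-by-$n$ matrices satisfies $\|C_{comp}-A\cdot B\|\le\mu(n)\varepsilon\|A\|\,\|B\|+O(\varepsilon^2)$ with $\mu(n)$ bounded by a polynomial in $n$. "Correct pivot order" means that no row exchanges are needed under partial pivoting, so that $L_{ii}=1$ and $|L_{ij}|\le1$. Algorithm $[L,U]=LUR(A)$ for $A$ $n$-by-$m$, $n\ge m$. Write $p=\lfloor m/2\rfloor$, $q=\lceil m/2\rceil$, MATLAB notation. If $m=1$: $L=A/A(1)$, $U=A(1)$. Otherwise: (a) $[L_L,U_L]=LUR(A(1:n,1:p))$; (b) $A(1:p,p+1:m)=(L_L(1:p,1:p))^{-1}\cdot A(1:p,p+1:m)$; (c) $A(p+1:n,p+1:m)=A(p+1:n,p+1:m)-L_L(p+1:n,1:p)\cdot A(1:p,p+1:m)$; (d) $[L_R,U_R]=LUR(A(p+1:n,p+1:m))$; (e) $L=[L_L,[zeros(p,q);L_R]]$; (f) $U=[[U_L,A(1:p,p+1:m)];[zeros(q,p),U_R]]$. In step (b) the triangular matrix is inverted (recursively)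 and the inverse is multiplied by the block. "$L$ is sufficiently well conditioned" means: $L$ (and so every diagonal block of $L$) is sufficiently well conditioned, and its norm sufficiently close to 1, that the error in the computed matrix from step (b), at every level of the recursion, is bounded in norm by $O(\varepsilon\|A\|)$. When $n>m$, $L^{-1}$ refers to the inverses of the square lower triangular diagonal blocks of $L$. *)

theory Defs
  imports Complex_Main "Jordan_Normal_Form.Gauss_Jordan_Elimination"
begin

text \<open>A norm on the space of real \<open>r\<close>-by-\<open>k\<close> matrices for every shape \<open>(r, k)\<close>.  Neither
  submultiplicativity nor any relation between the norms of different shapes is required.\<close>

definition matrix_norm :: "(real mat \<Rightarrow> real) \<Rightarrow> bool" where
  "matrix_norm N \<longleftrightarrow> (\<forall>r k. \<forall>A \<in> carrier_mat r k.
      0 \<le> N A \<and> (N A = 0 \<longleftrightarrow> A = 0\<^sub>m r k) \<and>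
      (\<forall>a. N (a \<cdot>\<^sub>m A) = \<bar>a\<bar> * N A) \<and>
      (\<forall>B \<in> carrier_mat r k. N (A + B) \<le> N A + N B))"

text \<open>The rounded operations of one arithmetic: scalar subtraction and division, and the
  multiplication algorithm for matrices.  Negation is exact.\<close>

record fp_arith =
  fl_sub :: "real \<Rightarrow> real \<Rightarrow> real"
  fl_div :: "real \<Rightarrow> real \<Rightarrow> real"
  fl_mm :: "real mat \<Rightarrow> real mat \<Rightarrow> real mat"

text \<open>A floating point arithmetic is a family \<open>F\<close> indexed by the machine epsilon \<open>\<epsilon>\<close>.\<close>

definition standard_fp_model :: "(real \<Rightarrow> fp_arith) \<Rightarrow> bool" where
  "standard_fp_model F \<longleftrightarrow> (\<forall>\<epsilon>>0. \<forall>x y.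
      (\<exists>\<delta>. \<bar>\<delta>\<bar> \<le> \<epsilon> \<and> fl_sub (F \<epsilon>) x y = (x - y) * (1 + \<delta>)) \<and>
      (y \<noteq> 0 \<longrightarrow> (\<exists>\<delta>. \<bar>\<delta>\<bar> \<le> \<epsilon> \<and> fl_div (F \<epsilon>) x y = x / y * (1 + \<delta>))))"

text \<open>The \<open>O(\<epsilon>\<^sup>2)\<close> term scales with the two factors, as floating point arithmetic does, so its
  constant \<open>\<nu>\<close> depends on the dimension only.  For a product of rectangular matrices \<open>n\<close> is the
  largest of the three dimensions.\<close>

definition stable_matmul :: "(real mat \<Rightarrow> real) \<Rightarrow> (nat \<Rightarrow> real) \<Rightarrow> (real \<Rightarrow> fp_arith) \<Rightarrow> bool" where
  "stable_matmul N \<mu> F \<longleftrightarrow> (\<forall>n. \<exists>\<nu>. \<exists>\<epsilon>0>0. \<forall>\<epsilon> r k s A B.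
      0 < \<epsilon> \<longrightarrow> \<epsilon> \<le> \<epsilon>0 \<longrightarrow> 0 < r \<longrightarrow> 0 < k \<longrightarrow> 0 < s \<longrightarrow> max r (max k s) = n \<longrightarrow>
      A \<in> carrier_mat r k \<longrightarrow> B \<in> carrier_mat k s \<longrightarrow>
      fl_mm (F \<epsilon>) A B \<in> carrier_mat r s \<and>
      N (fl_mm (F \<epsilon>) A B - A * B) \<le> \<mu> n * \<epsilon> * N A * N B + \<nu> * \<epsilon>\<^sup>2 * N A * N B)"

definition polynomially_bounded :: "(nat \<Rightarrow> real) \<Rightarrow> bool" where
  "polynomially_bounded \<mu> \<longleftrightarrow> (\<exists>a d. \<forall>n\<ge>1. \<mu> n \<le> a * real n ^ d)"

text \<open>Rows \<open>i, \<dots>, i' - 1\<close> and columns \<open>j, \<dots>, j' - 1\<close>, counted from \<open>0\<close>;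
  in MATLAB notation \<open>A(i+1:i', j+1:j')\<close>.\<close>

definition blk :: "'a mat \<Rightarrow> nat \<Rightarrow> nat \<Rightarrow> nat \<Rightarrow> nat \<Rightarrow> 'a mat" where
  "blk A i i' j j' = mat (i' - i) (j' - j) (\<lambda>(a, b). A $$ (i + a, j + b))"

lemma dim_blk [simp]: "dim_row (blk A i i' j j') = i' - i" "dim_col (blk A i i' j j') = j' - j"
  by (simp_all add: blk_def)

definition fl_sub_mat :: "fp_arith \<Rightarrow> real mat \<Rightarrow> real mat \<Rightarrow> real mat" where
  "fl_sub_mat F A B = mat (dim_row A) (dim_col A) (\<lambda>(i, j). fl_sub F (A $$ (i, j)) (B $$ (i, j)))"

lemma dim_fl_sub_mat [simp]:
  "dim_row (fl_sub_mat F A B) = dim_row A" "dim_col (fl_sub_mat F A B) = dim_col A"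
  by (simp_all add: fl_sub_mat_def)

text \<open>Recursive inversion of a lower triangular matrix, from
  \<open>[T11, 0; T21, T22]\<^sup>-\<^sup>1 = [T11\<^sup>-\<^sup>1, 0; -T22\<^sup>-\<^sup>1 T21 T11\<^sup>-\<^sup>1, T22\<^sup>-\<^sup>1]\<close>.\<close>

function fl_tri_inv :: "fp_arith \<Rightarrow> real mat \<Rightarrow> real mat" where
  "fl_tri_inv F T = (let n = dim_row T; p = n div 2 in
     if n \<le> 1 then mat n n (\<lambda>_. fl_div F 1 (T $$ (0, 0)))
     else
       let X11 = fl_tri_inv F (blk T 0 p 0 p);
           X22 = fl_tri_inv F (blk T p n p n);
           X21 = - fl_mm F (fl_mm F X22 (blk T p n 0 p)) X11
       in four_block_mat X11 (0\<^sub>m p (n - p)) X21 X22)"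
  by pat_completeness auto
termination by (relation "measure (\<lambda>(F, T). dim_row T)") auto

declare fl_tri_inv.simps [simp del]

text \<open>The left half \<open>A(1:n, 1:p)\<close>, and steps (b) and (c) when \<open>LL\<close> is the computed \<open>L_L\<close> of (a).\<close>

definition left_half :: "real mat \<Rightarrow> real mat" where
  "left_half A = blk A 0 (dim_row A) 0 (dim_col A div 2)"

definition lur_b :: "fp_arith \<Rightarrow> real mat \<Rightarrow> real mat \<Rightarrow> real mat" where
  "lur_b F LL A = (let m = dim_col A; p = m div 2 in
     fl_mm F (fl_tri_inv F (blk LL 0 p 0 p)) (blk A 0 p p m))"

definition lur_c :: "fp_arith \<Rightarrow> real mat \<Rightarrow> real mat \<Rightarrow> real mat" where
  "lur_c F LL A = (let n = dim_row A; m = dim_col A; p = m div 2 in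
     fl_sub_mat F (blk A p n p m) (fl_mm F (blk LL p n 0 p) (lur_b F LL A)))"

lemma dim_left_half [simp]:
  "dim_row (left_half A) = dim_row A" "dim_col (left_half A) = dim_col A div 2"
  by (simp_all add: left_half_def)

lemma dim_lur_c [simp]:
  "dim_row (lur_c F LL A) = dim_row A - dim_col A div 2"
  "dim_col (lur_c F LL A) = dim_col A - dim_col A div 2"
  by (simp_all add: lur_c_def Let_def)

function LUR :: "fp_arith \<Rightarrow> real mat \<Rightarrow> real mat \<times> real mat" where
  "LUR F A = (let n = dim_row A; m = dim_col A; p = m div 2; q = m - p in
     if m \<le> 1 then
       (mat n 1 (\<lambda>(i, j). fl_div F (A $$ (i, 0)) (A $$ (0, 0))), mat 1 1 (\<lambda>_. A $$ (0, 0)))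
     else
       let (LL, UL) = LUR F (left_half A);
           (LR, UR) = LUR F (lur_c F LL A)
       in (four_block_mat (blk LL 0 p 0 p) (0\<^sub>m p q) (blk LL p n 0 p) LR,
           four_block_mat UL (lur_b F LL A) (0\<^sub>m q p) UR))"
  by pat_completeness auto
termination by (relation "measure (\<lambda>(F, A). dim_col A)") auto

declare LUR.simps [simp del]

text \<open>All matrices on which \<open>LUR\<close> is called when it is run on \<open>A\<close>.\<close>

inductive_set LUR_calls :: "fp_arith \<Rightarrow> real mat \<Rightarrow> real mat set" for F A where
  top: "A \<in> LUR_calls F A"
| left: "B \<in> LUR_calls F A \<Longrightarrow> 1 < dim_col B \<Longrightarrow> left_half B \<in> LUR_calls F A"
| right: "B \<in> LUR_calls F A \<Longrightarrow> 1 < dim_col B \<Longrightarrow>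
    lur_c F (fst (LUR F (left_half B))) B \<in> LUR_calls F A"

text \<open>Partial pivoting chooses its pivot in the single columns reached by the recursion, as they are
  computed.  The rows are in the correct order when the first entry of each such column is nonzero and
  of maximal modulus; the column of \<open>L\<close> obtained by dividing by it is then \<open>1\<close> on the diagonal and
  at most \<open>1\<close> in modulus below it (up to the rounding of the quotient, unless division is
  correctly rounded).\<close>

definition correct_pivot_order :: "fp_arith \<Rightarrow> real mat \<Rightarrow> bool" where
  "correct_pivot_order F A \<longleftrightarrow> (\<forall>B \<in> LUR_calls F A. dim_col B = 1 \<longrightarrow>
      B $$ (0, 0) \<noteq> 0 \<and> (\<forall>i < dim_row B. \<bar>B $$ (i, 0)\<bar> \<le> \<bar>B $$ (0, 0)\<bar>))"

text \<open>\<open>mat_inverse\<close> is exact Gauss-Jordan inversion.  It is applied only to triangular matrices whose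
  diagonal consists of computed quotients \<open>x / x\<close>, which are nonzero for \<open>\<epsilon> < 1\<close>.\<close>

abbreviation exact_inv :: "real mat \<Rightarrow> real mat" where
  "exact_inv T \<equiv> the (mat_inverse T)"

text \<open>At every level of the recursion the computed matrix from step (b) differs from the exact
  \<open>L_L(1:p,1:p)\<^sup>-\<^sup>1 B(1:p,p+1:m)\<close> by at most \<open>c \<epsilon> \<parallel>A\<parallel>\<close>, where \<open>B\<close> is the current matrix and \<open>A\<close> the
  input at the top level.\<close>

definition sufficiently_well_conditioned ::
    "(real mat \<Rightarrow> real) \<Rightarrow> fp_arith \<Rightarrow> real \<Rightarrow> real \<Rightarrow> real mat \<Rightarrow> bool" where
  "sufficiently_well_conditioned N F \<epsilon> c A \<longleftrightarrow> (\<forall>B \<in> LUR_calls F A. 1 < dim_col B \<longrightarrow>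
     (let m = dim_col B; p = m div 2; LL = fst (LUR F (left_half B)) in
        N (lur_b F LL B - exact_inv (blk LL 0 p 0 p) * blk B 0 p p m) \<le> c * \<epsilon> * N A))"

end

theory Submission
  imports Defs "Jordan_Normal_Form.Determinant"
begin

text \<open>
  All norms on matrices of one shape are equivalent, so up to factors depending on \<open>n\<close> every
  bound may be stated for the largest modulus of an entry; this is what links the norms of a matrix,
  of its blocks and of the matrices deeper in the recursion.

  In that norm the argument is an induction over the recursion.  Write \<open>T\<close> and \<open>L\<^sub>2\<^sub>1\<close> for the upper
  and lower part of the computed \<open>L\<^sub>L\<close>, \<open>X\<close> for the computed block of step (b), and \<open>C\<close> for the
  computed Schur complement of step (c).  Then \<open>L \<cdot> U\<close> has the blocks
  \<open>L\<^sub>L \<cdot> U\<^sub>L\<close> (left), \<open>T \<cdot> X\<close> (upper right) and \<open>L\<^sub>2\<^sub>1 \<cdot> X + L\<^sub>R \<cdot> U\<^sub>R\<close> (lower right), and they differ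
  from those of \<open>A\<close> as follows.

  \<^item> The left block by the backward error of the first recursive call.

  \<^item> The upper right block by \<open>T \<cdot> (X - T\<^sup>-\<^sup>1 \<cdot> A\<^sub>1\<^sub>2)\<close>; here the assumed accuracy of step (b)
    enters.

  \<^item> The lower right block by \<open>(L\<^sub>2\<^sub>1 \<cdot> X + C - A\<^sub>2\<^sub>2) + (L\<^sub>R \<cdot> U\<^sub>R - C)\<close>: the rounding of one matrix
    product and one subtraction, and the backward error of the second recursive call.

  All these are \<open>O(\<epsilon>)\<close> times the size of \<open>A\<close> provided that \<open>X\<close> and \<open>C\<close> are bounded by a multiple
  of the size of \<open>A\<close>.  Pivoting ensures this: the entries of the computed \<open>L\<close> have modulus at most
  \<open>1 + \<epsilon>\<close> and its diagonal entries are at least \<open>1 - \<epsilon>\<close> (\<open>LUR_shape\<close>), so that forward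
  substitution bounds \<open>T\<^sup>-\<^sup>1 \<cdot> A\<^sub>1\<^sub>2\<close> by a multiple of \<open>A\<^sub>1\<^sub>2\<close> that depends on the dimension only
  (\<open>forward_substitution_bound\<close>), and \<open>X\<close> differs from it by \<open>O(\<epsilon>)\<close>.  One level of the recursion is \<open>recursion_step_bounds\<close>, the
  induction is \<open>LUR_backward_error\<close>.
\<close>

section \<open>Norms on a finite-dimensional space are equivalent\<close>

text \<open>Coordinates are functions on an index type, restricted to finite support, since the
  matrices of one shape do not form a type to which the classes of normed spaces could apply.\<close>

locale function_seminorm =
  fixes p :: "('i \<Rightarrow> real) \<Rightarrow> real"
  assumes triangle: "p (\<lambda>i. a i + b i) \<le> p a + p b"
    and scale: "p (\<lambda>i. t * a i) = \<bar>t\<bar> * p a"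
begin

lemma zero [simp]: "p (\<lambda>_. 0) = 0"
  using scale[of 0 "\<lambda>_. 0"] by simp

lemma uminus: "p (\<lambda>i. - a i) = p a"
  using scale[of "-1" a] by simp

lemma nonneg: "0 \<le> p a"
  using triangle[of a "\<lambda>i. - a i"] by (simp add: uminus)

lemma triangle_diff: "p (\<lambda>i. a i - b i) \<le> p a + p b"
  using triangle[of a "\<lambda>i. - b i"] by (simp add: uminus)

lemma le_sum_coefficients:
  assumes "finite J" and "\<And>i. i \<notin> J \<Longrightarrow> a i = 0"
  shows "p a \<le> (\<Sum>i\<in>J. \<bar>a i\<bar> * p (\<lambda>j. of_bool (j = i)))"
  using assms
proof (induction J arbitrary: a rule: finite_induct)
  case empty
  then have "a = (\<lambda>_. 0)" by auto
  then show ?case by simp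
next
  case (insert v J)
  have "a = (\<lambda>i. (a(v := 0)) i + a v * of_bool (i = v))"
    by auto
  then have "p a \<le> p (a(v := 0)) + \<bar>a v\<bar> * p (\<lambda>j. of_bool (j = v))"
    by (metis scale triangle)
  moreover have "p (a(v := 0)) \<le> (\<Sum>i\<in>J. \<bar>(a(v := 0)) i\<bar> * p (\<lambda>j. of_bool (j = i)))"
    by (rule insert.IH) (use insert.prems in auto)
  moreover have "\<dots> = (\<Sum>i\<in>J. \<bar>a i\<bar> * p (\<lambda>j. of_bool (j = i)))"
    using insert.hyps by (intro sum.cong) auto
  ultimately show ?case
    using insert.hyps by simp
qed

text \<open>Were the distance of the new basis vector \<open>e\<close> to the span of the old ones zero, the
  coefficients of vectors \<open>a\<^sub>n\<close> with \<open>p (e + a\<^sub>n) \<rightarrow> 0\<close> would be Cauchy sequences, by the bound \<open>C\<close> on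
  the old coordinates.  Their limit \<open>b\<close> would satisfy \<open>p (e + b) = 0\<close>, contradicting definiteness.
  The completeness of the reals is essential here.\<close>

lemma distance_to_span_pos:
  assumes J: "finite J" "v \<notin> J"
    and C: "\<And>a i. (\<And>i. i \<notin> J \<Longrightarrow> a i = 0) \<Longrightarrow> i \<in> J \<Longrightarrow> \<bar>a i\<bar> \<le> C * p a"
    and definite: "\<And>a. (\<And>i. i \<notin> insert v J \<Longrightarrow> a i = 0) \<Longrightarrow> p a = 0 \<Longrightarrow> a = (\<lambda>_. 0)"
  shows "\<exists>d>0. \<forall>a. (\<forall>i. i \<notin> J \<longrightarrow> a i = 0) \<longrightarrow> d \<le> p (\<lambda>i. of_bool (i = v) + a i)"
proof (rule ccontr)
  assume neg: "\<not> ?thesis"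
  define e :: "'i \<Rightarrow> real" where "e = (\<lambda>i. of_bool (i = v))"
  have "\<exists>a. (\<forall>i. i \<notin> J \<longrightarrow> a i = 0) \<and> p (\<lambda>i. e i + a i) < inverse (real (Suc n))" for n
  proof -
    have "0 < inverse (real (Suc n))" by simp
    with neg show ?thesis unfolding e_def by (meson not_le)
  qed
  then obtain a where supp: "\<And>n i. i \<notin> J \<Longrightarrow> a n i = 0"
    and small: "\<And>n. p (\<lambda>i. e i + a n i) < inverse (real (Suc n))"
    by metis
  have C_nonneg: "0 \<le> \<bar>C\<bar>" by simp
  have close: "\<bar>a n i - a k i\<bar> \<le> \<bar>C\<bar> * (inverse (real (Suc n)) + inverse (real (Suc k)))" for n k i
  proof (cases "i \<in> J")
    case True
    have "p (\<lambda>i. (e i + a n i) - (e i + a k i)) \<le> p (\<lambda>i. e i + a n i) + p (\<lambda>i. e i + a k i)"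
      by (rule triangle_diff)
    then have "p (\<lambda>i. a n i - a k i) \<le> inverse (real (Suc n)) + inverse (real (Suc k))"
      using small[of n] small[of k] by simp
    moreover have "\<bar>a n i - a k i\<bar> \<le> C * p (\<lambda>i. a n i - a k i)"
      by (rule C) (use True supp in auto)
    moreover have "C * p (\<lambda>i. a n i - a k i) \<le> \<bar>C\<bar> * p (\<lambda>i. a n i - a k i)"
      by (intro mult_right_mono nonneg) auto
    ultimately show ?thesis
      by (meson C_nonneg mult_left_mono order_trans)
  qed (simp add: supp)
  have "Cauchy (\<lambda>n. a n i)" for i
  proof (rule CauchyI)
    fix r :: real assume r: "0 < r"
    obtain n0 where n0: "inverse (real (Suc n0)) < r / (2 * (\<bar>C\<bar> + 1))"
      using reals_Archimedean[of "r / (2 * (\<bar>C\<bar> + 1))"] r by auto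
    have half: "r / (2 * (\<bar>C\<bar> + 1)) = r / (\<bar>C\<bar> + 1) / 2" by simp
    have "norm (a n i - a k i) < r" if "n0 \<le> n" "n0 \<le> k" for n k
    proof -
      have "inverse (real (Suc n)) \<le> inverse (real (Suc n0))"
        "inverse (real (Suc k)) \<le> inverse (real (Suc n0))"
        using that by auto
      then have "inverse (real (Suc n)) + inverse (real (Suc k))
          \<le> inverse (real (Suc n0)) + inverse (real (Suc n0))"
        by (rule add_mono)
      also have "\<dots> < r / (2 * (\<bar>C\<bar> + 1)) + r / (2 * (\<bar>C\<bar> + 1))"
        by (intro add_strict_mono n0)
      also have "\<dots> = r / (\<bar>C\<bar> + 1)"
        unfolding half by (rule field_sum_of_halves)
      finally have "inverse (real (Suc n)) + inverse (real (Suc k)) < r / (\<bar>C\<bar> + 1)" .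
      then have "(\<bar>C\<bar> + 1) * (inverse (real (Suc n)) + inverse (real (Suc k))) < r"
        by (simp add: pos_less_divide_eq mult.commute)
      moreover have "0 < inverse (real (Suc n)) + inverse (real (Suc k))"
        by (intro add_pos_pos) auto
      ultimately show ?thesis
        using close[of n i k] by (simp add: distrib_right)
    qed
    then show "\<exists>M. \<forall>m\<ge>M. \<forall>n\<ge>M. norm (a m i - a n i) < r" by blast
  qed
  then have "\<exists>l. (\<lambda>n. a n i) \<longlonglongrightarrow> l" for i
    by (meson convergent_def real_Cauchy_convergent)
  then obtain b where b: "\<And>i. (\<lambda>n. a n i) \<longlonglongrightarrow> b i" by metis
  have b_supp: "b i = 0" if "i \<notin> J" for i
    using b[of i] supp[OF that] by (simp add: LIMSEQ_const_iff)
  define w where "w n = inverse (real (Suc n)) + (\<Sum>i\<in>J. \<bar>b i - a n i\<bar> * p (\<lambda>j. of_bool (j = i)))" for n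
  have "p (\<lambda>i. e i + b i) \<le> w n" for n
  proof -
    have "p (\<lambda>i. (e i + a n i) + (b i - a n i)) \<le> p (\<lambda>i. e i + a n i) + p (\<lambda>i. b i - a n i)"
      by (rule triangle)
    moreover have "p (\<lambda>i. b i - a n i) \<le> (\<Sum>i\<in>J. \<bar>b i - a n i\<bar> * p (\<lambda>j. of_bool (j = i)))"
      by (rule le_sum_coefficients) (use J b_supp supp in auto)
    ultimately show ?thesis
      using small[of n] by (simp add: w_def)
  qed
  moreover have "w \<longlonglongrightarrow> 0 + (\<Sum>i\<in>J. \<bar>b i - b i\<bar> * p (\<lambda>j. of_bool (j = i)))"
    unfolding w_def by (intro tendsto_intros b LIMSEQ_inverse_real_of_nat)
  ultimately have "p (\<lambda>i. e i + b i) \<le> 0"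
    by (intro LIMSEQ_le_const[of w]) auto
  then have "p (\<lambda>i. e i + b i) = 0"
    using nonneg[of "\<lambda>i. e i + b i"] by linarith
  then have "(\<lambda>i. e i + b i) = (\<lambda>_. 0)"
    by (intro definite) (auto simp: e_def b_supp)
  then have "e v + b v = 0" by metis
  then show False
    using J b_supp[of v] by (simp add: e_def)
qed

text \<open>The nontrivial half of the equivalence of norms, by adding one basis vector \<open>e\<close> at a time.
  The positive distance of \<open>e\<close> to the earlier span bounds the new coordinate; once its
  contribution is subtracted, the induction hypothesis bounds the others.\<close>

lemma coefficients_le:
  assumes "finite J"
    and "\<And>a. (\<And>i. i \<notin> J \<Longrightarrow> a i = 0) \<Longrightarrow> p a = 0 \<Longrightarrow> a = (\<lambda>_. 0)"
  shows "\<exists>C\<ge>0. \<forall>a. (\<forall>i. i \<notin> J \<longrightarrow> a i = 0) \<longrightarrow> (\<forall>i. \<bar>a i\<bar> \<le> C * p a)"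
  using assms
proof (induction J rule: finite_induct)
  case empty
  have "\<forall>a. (\<forall>i. i \<notin> {} \<longrightarrow> a i = 0) \<longrightarrow> (\<forall>i. \<bar>a i\<bar> \<le> 0 * p a)" by auto
  then show ?case by blast
next
  case (insert v J)
  have "\<exists>C\<ge>0. \<forall>a. (\<forall>i. i \<notin> J \<longrightarrow> a i = 0) \<longrightarrow> (\<forall>i. \<bar>a i\<bar> \<le> C * p a)"
    by (rule insert.IH) (rule insert.prems, auto)
  then obtain C where C: "C \<ge> 0" "\<And>a i. (\<And>i. i \<notin> J \<Longrightarrow> a i = 0) \<Longrightarrow> \<bar>a i\<bar> \<le> C * p a"
    by blast
  obtain d where d: "0 < d"
    "\<And>a. (\<And>i. i \<notin> J \<Longrightarrow> a i = 0) \<Longrightarrow> d \<le> p (\<lambda>i. of_bool (i = v) + a i)"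
    using distance_to_span_pos[OF insert.hyps C(2) insert.prems] by blast
  define e :: "'i \<Rightarrow> real" where "e = (\<lambda>i. of_bool (i = v))"
  define C' where "C' = 1 / d + C * (1 + p e / d)"
  have C': "0 \<le> 1 / d" "0 \<le> C * (1 + p e / d)"
    using C(1) d(1) nonneg by auto
  have "\<bar>a i\<bar> \<le> C' * p a" if supp: "\<And>i. i \<notin> insert v J \<Longrightarrow> a i = 0" for a i
  proof -
    have at_v: "\<bar>a v\<bar> \<le> p a / d"
    proof (cases "a v = 0")
      case False
      have "a = (\<lambda>i. a v * (of_bool (i = v) + (a(v := 0)) i / a v))"
        using False by auto
      then have "p a = \<bar>a v\<bar> * p (\<lambda>i. of_bool (i = v) + (a(v := 0)) i / a v)"
        by (metis scale)
      moreover have "d \<le> p (\<lambda>i. of_bool (i = v) + (a(v := 0)) i / a v)"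
        by (rule d(2)) (use supp in auto)
      ultimately have "\<bar>a v\<bar> * d \<le> p a"
        by (simp add: mult_left_mono)
      then show ?thesis
        using d(1) by (simp add: pos_le_divide_eq)
    qed (use d nonneg in simp)
    have rest: "\<bar>a i\<bar> \<le> C * (1 + p e / d) * p a" if "i \<noteq> v"
    proof -
      have "a(v := 0) = (\<lambda>i. a i - a v * e i)"
        by (auto simp: e_def)
      then have "p (a(v := 0)) \<le> p a + \<bar>a v\<bar> * p e"
        by (metis triangle_diff scale)
      also have "\<dots> \<le> p a + p a / d * p e"
        using at_v by (intro add_left_mono mult_right_mono nonneg)
      finally have "p (a(v := 0)) \<le> (1 + p e / d) * p a"
        by (simp add: algebra_simps)
      moreover have "\<bar>(a(v := 0)) i\<bar> \<le> C * p (a(v := 0))"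
        by (rule C(2)) (use supp in auto)
      ultimately have "\<bar>a i\<bar> \<le> C * ((1 + p e / d) * p a)"
        using that C(1) by (smt (verit) fun_upd_other mult_left_mono)
      then show ?thesis by (simp add: mult.assoc)
    qed
    have "0 \<le> 1 / d * p a" "0 \<le> C * (1 + p e / d) * p a"
      using C' nonneg by (simp_all only: mult_nonneg_nonneg)
    moreover have "p a / d = 1 / d * p a" by simp
    ultimately have "\<bar>a i\<bar> \<le> 1 / d * p a + C * (1 + p e / d) * p a"
    proof (cases "i = v")
      case True
      then show ?thesis
        using at_v by (simp only: \<open>p a / d = 1 / d * p a\<close>)
          (rule add_increasing2[OF \<open>0 \<le> C * (1 + p e / d) * p a\<close>])
    next
      case False
      show ?thesis
        by (rule add_increasing[OF \<open>0 \<le> 1 / d * p a\<close> rest[OF False]])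
    qed
    then show ?thesis by (simp only: C'_def distrib_right)
  qed
  moreover have "0 \<le> C'" using C' by (simp add: C'_def)
  ultimately show ?case by blast
qed

end

definition entries_le :: "real mat \<Rightarrow> real \<Rightarrow> bool" where
  "entries_le A a \<longleftrightarrow> (\<forall>i < dim_row A. \<forall>j < dim_col A. \<bar>A $$ (i, j)\<bar> \<le> a)"

lemma entries_leD: "entries_le A a \<Longrightarrow> i < dim_row A \<Longrightarrow> j < dim_col A \<Longrightarrow> \<bar>A $$ (i, j)\<bar> \<le> a"
  by (simp add: entries_le_def)

lemma entries_le_mono: "entries_le A a \<Longrightarrow> a \<le> b \<Longrightarrow> entries_le A b"
  by (meson entries_le_def order_trans)

lemma matrix_norm_entries:
  assumes N: "matrix_norm N"
  shows "\<exists>C\<ge>0. \<forall>A \<in> carrier_mat r k.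
    entries_le A (C * N A) \<and> (\<forall>a\<ge>0. entries_le A a \<longrightarrow> N A \<le> C * a)"
proof -
  define p :: "(nat \<times> nat \<Rightarrow> real) \<Rightarrow> real" where "p a = N (mat r k a)" for a
  define J where "J = {..<r} \<times> {..<k}"
  have Nrk: "N A = 0 \<longleftrightarrow> A = 0\<^sub>m r k" "N (t \<cdot>\<^sub>m A) = \<bar>t\<bar> * N A" "N (A + B) \<le> N A + N B"
    if "A \<in> carrier_mat r k" "B \<in> carrier_mat r k" for A B t
    using N that unfolding matrix_norm_def by blast+
  interpret function_seminorm p
  proof
    fix a b :: "nat \<times> nat \<Rightarrow> real" and t :: real
    have "mat r k (\<lambda>i. a i + b i) = mat r k a + mat r k b" by (intro eq_matI) auto
    then show "p (\<lambda>i. a i + b i) \<le> p a + p b" unfolding p_def using Nrk(3) by simp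
    have "mat r k (\<lambda>i. t * a i) = t \<cdot>\<^sub>m mat r k a" by (intro eq_matI) auto
    then show "p (\<lambda>i. t * a i) = \<bar>t\<bar> * p a"
      unfolding p_def using Nrk(2)[of "mat r k a" "mat r k a"] by simp
  qed
  have J: "finite J" by (simp add: J_def)
  have "a = (\<lambda>_. 0)" if supp: "\<And>i. i \<notin> J \<Longrightarrow> a i = 0" and "p a = 0" for a
  proof
    fix i :: "nat \<times> nat"
    have "mat r k a = 0\<^sub>m r k"
      using \<open>p a = 0\<close> Nrk(1)[of "mat r k a" "mat r k a"] by (simp add: p_def)
    then have "a i = 0" if "i \<in> J"
      using that unfolding J_def by (metis (no_types, lifting) index_mat(1) index_zero_mat(1) SigmaE lessThan_iff)
    then show "a i = 0" using supp by blast
  qed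
  then obtain C where C: "0 \<le> C"
    "\<And>a i. (\<And>i. i \<notin> J \<Longrightarrow> a i = 0) \<Longrightarrow> \<bar>a i\<bar> \<le> C * p a"
    using coefficients_le[OF J] by blast
  define D where "D = (\<Sum>i\<in>J. p (\<lambda>j. of_bool (j = i)))"
  have D: "0 \<le> D" unfolding D_def by (intro sum_nonneg nonneg)
  have "entries_le A ((C + D) * N A) \<and> (\<forall>a\<ge>0. entries_le A a \<longrightarrow> N A \<le> (C + D) * a)"
    if A: "A \<in> carrier_mat r k" for A
  proof -
    define a where "a i = (if i \<in> J then A $$ i else 0)" for i
    have matA: "mat r k a = A"
      by (rule eq_matI) (use A in \<open>auto simp: a_def J_def\<close>)
    have pa: "p a = N A" by (simp add: p_def matA)
    have NA: "0 \<le> N A" using nonneg[of a] pa by simp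
    have "\<bar>A $$ (i, j)\<bar> \<le> C * N A" if "i < r" "j < k" for i j
      using C(2)[of a "(i, j)"] that by (simp add: a_def J_def pa)
    moreover have "C * N A \<le> (C + D) * N A"
      using D NA by (intro mult_right_mono) auto
    ultimately have "entries_le A ((C + D) * N A)"
      using A by (auto simp: entries_le_def intro: order_trans)
    moreover have "N A \<le> (C + D) * b" if b: "0 \<le> b" "entries_le A b" for b
    proof -
      have "p a \<le> (\<Sum>i\<in>J. \<bar>a i\<bar> * p (\<lambda>j. of_bool (j = i)))"
        by (rule le_sum_coefficients[OF J]) (simp add: a_def)
      also have "\<dots> \<le> (\<Sum>i\<in>J. b * p (\<lambda>j. of_bool (j = i)))"
        using b A by (intro sum_mono mult_right_mono nonneg) (auto simp: a_def J_def entries_le_def)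
      also have "\<dots> = D * b" by (simp add: D_def sum_distrib_left mult.commute)
      also have "\<dots> \<le> (C + D) * b" using C(1) b by (intro mult_right_mono) auto
      finally show ?thesis by (simp add: pa)
    qed
    ultimately show ?thesis by blast
  qed
  then show ?thesis using C(1) D by (intro exI[of _ "C + D"]) auto
qed

lemma matrix_norm_entries_uniform:
  assumes N: "matrix_norm N"
  shows "\<exists>C\<ge>0. \<forall>r\<le>n. \<forall>k\<le>n. \<forall>A \<in> carrier_mat r k.
    entries_le A (C * N A) \<and> (\<forall>a\<ge>0. entries_le A a \<longrightarrow> N A \<le> C * a)"
proof -
  obtain C where C: "\<And>r k. 0 \<le> C r k"
    "\<And>r k A. A \<in> carrier_mat r k \<Longrightarrow> entries_le A (C r k * N A)"
    "\<And>r k A a. A \<in> carrier_mat r k \<Longrightarrow> 0 \<le> a \<Longrightarrow> entries_le A a \<Longrightarrow> N A \<le> C r k * a"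
    using matrix_norm_entries[OF N] by metis
  define D where "D = (\<Sum>r\<le>n. \<Sum>k\<le>n. C r k)"
  have CD: "C r k \<le> D" if "r \<le> n" "k \<le> n" for r k
  proof -
    have "C r k \<le> (\<Sum>k\<le>n. C r k)"
      using that by (intro member_le_sum) (auto simp: C)
    also have "\<dots> \<le> D" unfolding D_def
      using that by (intro member_le_sum[of r _ "\<lambda>r. \<Sum>k\<le>n. C r k"]) (auto simp: C sum_nonneg)
    finally show ?thesis .
  qed
  have "0 \<le> D" unfolding D_def by (intro sum_nonneg C)
  moreover have "0 \<le> N A" if "A \<in> carrier_mat r k" for A r k
    using N that unfolding matrix_norm_def by blast
  ultimately show ?thesis
    using C CD by (intro exI[of _ D]) (smt (verit) entries_le_mono mult_right_mono)
qed

section \<open>Entrywise bounds\<close>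

lemma entries_le_mult:
  assumes "A \<in> carrier_mat r k" "B \<in> carrier_mat k s" "entries_le A a" "entries_le B b"
    and "0 \<le> a"
  shows "entries_le (A * B) (real k * a * b)"
  unfolding entries_le_def
proof (intro allI impI)
  fix i j assume ij: "i < dim_row (A * B)" "j < dim_col (A * B)"
  have "\<bar>(A * B) $$ (i, j)\<bar> = \<bar>\<Sum>l = 0..<k. A $$ (i, l) * B $$ (l, j)\<bar>"
    using assms(1,2) ij by (simp add: scalar_prod_def)
  also have "\<dots> \<le> (\<Sum>l = 0..<k. \<bar>A $$ (i, l)\<bar> * \<bar>B $$ (l, j)\<bar>)"
    by (metis (no_types, lifting) abs_mult order.refl sum_abs sum.cong)
  also have "\<dots> \<le> (\<Sum>l = 0..<k. a * b)"
    using assms ij by (intro sum_mono mult_mono) (auto simp: entries_le_def)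
  finally show "\<bar>(A * B) $$ (i, j)\<bar> \<le> real k * a * b" by (simp add: mult.assoc)
qed

lemma entries_le_add:
  assumes "A \<in> carrier_mat r k" "B \<in> carrier_mat r k" "entries_le A a" "entries_le B b"
  shows "entries_le (A + B) (a + b)"
  using assms unfolding entries_le_def by (auto intro!: order_trans[OF abs_triangle_ineq] add_mono)

lemma entries_le_blk:
  assumes "entries_le A a" "i' \<le> dim_row A" "j' \<le> dim_col A"
  shows "entries_le (blk A i i' j j') a"
  using assms by (auto simp: entries_le_def blk_def)

lemma blk_carrier [simp, intro]: "blk A i i' j j' \<in> carrier_mat (i' - i) (j' - j)"
  by (simp add: blk_def)

lemma blk_mult_right:
  assumes "A \<in> carrier_mat r k" "B \<in> carrier_mat k s" "i' \<le> r"
  shows "blk A i i' 0 k * B = blk (A * B) i i' 0 s"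
  using assms by (intro eq_matI) (auto simp: blk_def scalar_prod_def)

text \<open>The shape of a computed \<open>L\<close>, which may have more rows than columns.  Its diagonal entries are
  rounded quotients \<open>x / x\<close>, so they are at least \<open>1 - \<epsilon>\<close>; the bound \<open>1/2\<close> covers every
  \<open>\<epsilon> \<le> 1/2\<close>.\<close>

definition lower_pivotal :: "real mat \<Rightarrow> bool" where
  "lower_pivotal T \<longleftrightarrow>
     (\<forall>j < dim_col T. 1/2 \<le> T $$ (j, j) \<and> (\<forall>i < j. T $$ (i, j) = 0))"

lemma lower_pivotal_exact_inv:
  assumes T: "T \<in> carrier_mat p p" and "lower_pivotal T"
  shows "exact_inv T \<in> carrier_mat p p" "T * exact_inv T = 1\<^sub>m p"
proof -
  have "det T = prod_list (diag_mat T)"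
    by (rule det_lower_triangular[OF _ T]) (use assms in \<open>auto simp: lower_pivotal_def\<close>)
  moreover have "0 \<notin> set (diag_mat T)"
    using assms by (force simp: diag_mat_def lower_pivotal_def)
  ultimately have "det T \<noteq> 0" by simp
  then have "T \<in> Units (ring_mat TYPE(real) p ())"
    by (rule det_non_zero_imp_unit[OF T])
  then obtain X where X: "mat_inverse T = Some X"
    using mat_inverse(1)[OF T, where b = "()"] by (cases "mat_inverse T") auto
  then show "exact_inv T \<in> carrier_mat p p" "T * exact_inv T = 1\<^sub>m p"
    using mat_inverse(2)[OF T X] by auto
qed

text \<open>From \<open>T\<^sub>i\<^sub>i X\<^sub>i = B\<^sub>i - (\<Sum>l<i. T\<^sub>i\<^sub>l X\<^sub>l)\<close> the bounds \<open>x\<^sub>i\<close> on the rows of \<open>X\<close> satisfy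
  \<open>x\<^sub>i \<le> 2 (b + 2 (x\<^sub>0 + \<dots> + x\<^sub>i\<^sub>-\<^sub>1))\<close>, which \<open>x\<^sub>i = 2 \<cdot> 5\<^sup>i \<cdot> b\<close> solves with equality.\<close>

lemma forward_substitution_bound:
  assumes T: "T \<in> carrier_mat p p" and X: "X \<in> carrier_mat p q"
    and "lower_pivotal T" "entries_le T 2" and b: "entries_le (T * X) b"
  shows "entries_le X (2 * 5 ^ p * b)"
proof -
  have bound: "\<bar>X $$ (i, j)\<bar> \<le> 2 * 5 ^ i * b" if "i < p" "j < q" for i j
    using that(1)
  proof (induction i rule: less_induct)
    case (less i)
    have geo: "(\<Sum>l = 0..<i. 4 * (5::real) ^ l) = 5 ^ i - 1" for i
      by (induction i) auto
    have "(T * X) $$ (i, j) = (\<Sum>l = 0..<p. T $$ (i, l) * X $$ (l, j))"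
      using T X less.prems that(2) by (simp add: scalar_prod_def)
    also have "\<dots> = (\<Sum>l = 0..<Suc i. T $$ (i, l) * X $$ (l, j))"
      using less.prems T assms(3) by (intro sum.mono_neutral_right) (auto simp: lower_pivotal_def)
    finally have eq: "T $$ (i, i) * X $$ (i, j)
        = (T * X) $$ (i, j) - (\<Sum>l = 0..<i. T $$ (i, l) * X $$ (l, j))"
      by simp
    have "\<bar>\<Sum>l = 0..<i. T $$ (i, l) * X $$ (l, j)\<bar> \<le> (\<Sum>l = 0..<i. 2 * (2 * 5 ^ l * b))"
    proof (intro order_trans[OF sum_abs] sum_mono)
      fix l assume "l \<in> {0..<i}"
      then have "l < i" by simp
      then have "\<bar>T $$ (i, l)\<bar> \<le> 2" "\<bar>X $$ (l, j)\<bar> \<le> 2 * 5 ^ l * b"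
        using less T assms(4) by (auto simp: entries_le_def)
      then show "\<bar>T $$ (i, l) * X $$ (l, j)\<bar> \<le> 2 * (2 * 5 ^ l * b)"
        unfolding abs_mult by (intro mult_mono) auto
    qed
    also have "\<dots> = (5 ^ i - 1) * b"
      unfolding geo[symmetric] sum_distrib_right by (intro sum.cong) auto
    finally have "\<bar>T $$ (i, i) * X $$ (i, j)\<bar> \<le> b + (5 ^ i - 1) * b"
      unfolding eq using entries_leD[OF b, of i j] T X less.prems that(2) by simp
    then have "T $$ (i, i) * \<bar>X $$ (i, j)\<bar> \<le> 5 ^ i * b"
      using assms(3) T less.prems by (auto simp: lower_pivotal_def abs_mult algebra_simps)
    moreover have "1/2 * \<bar>X $$ (i, j)\<bar> \<le> T $$ (i, i) * \<bar>X $$ (i, j)\<bar>"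
      using assms(3) T less.prems by (intro mult_right_mono) (auto simp: lower_pivotal_def)
    ultimately show ?case by linarith
  qed
  show ?thesis
    unfolding entries_le_def
  proof (intro allI impI)
    fix i j assume "i < dim_row X" "j < dim_col X"
    then have ij: "i < p" "j < q" using X by auto
    have b0: "0 \<le> b" using entries_leD[OF b, of 0 j] T X ij by force
    have "(5::real) ^ i \<le> 5 ^ p" using ij by (intro power_increasing) auto
    then have "2 * 5 ^ i * b \<le> 2 * 5 ^ p * b" using b0 by (intro mult_right_mono) auto
    then show "\<bar>X $$ (i, j)\<bar> \<le> 2 * 5 ^ p * b" using bound[OF ij] by linarith
  qed
qed

section \<open>The recursion tree\<close>

lemma LUR_simps_1:
  assumes "A \<in> carrier_mat n 1"
  shows "LUR F A = (mat n 1 (\<lambda>(i, j). fl_div F (A $$ (i, 0)) (A $$ (0, 0))), mat 1 1 (\<lambda>_. A $$ (0, 0)))"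
  using assms by (subst LUR.simps) (simp add: Let_def)

lemma LUR_simps_rec:
  assumes "A \<in> carrier_mat n m" "1 < m" "p = m div 2" "LUR F (left_half A) = (LL, UL)"
    "LUR F (lur_c F LL A) = (LR, UR)"
  shows "LUR F A = (four_block_mat (blk LL 0 p 0 p) (0\<^sub>m p (m - p)) (blk LL p n 0 p) LR,
           four_block_mat UL (lur_b F LL A) (0\<^sub>m (m - p) p) UR)"
  using assms by (subst LUR.simps) (simp add: Let_def)

lemma LUR_calls_trans:
  assumes "C \<in> LUR_calls F B" "B \<in> LUR_calls F A"
  shows "C \<in> LUR_calls F A"
  using assms by (induction rule: LUR_calls.induct) (auto intro: LUR_calls.intros)

lemma correct_pivot_order_call:
  "correct_pivot_order F A \<Longrightarrow> B \<in> LUR_calls F A \<Longrightarrow> correct_pivot_order F B"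
  unfolding correct_pivot_order_def by (meson LUR_calls_trans)

text \<open>The conditioning hypothesis in terms of entries.  The bound \<open>e\<close> is absolute, not relative
  to \<open>A\<close>, so that it passes unchanged to the recursive calls.\<close>

definition step_b_error_le :: "fp_arith \<Rightarrow> real mat \<Rightarrow> real \<Rightarrow> bool" where
  "step_b_error_le F A e \<longleftrightarrow> (\<forall>B \<in> LUR_calls F A. 1 < dim_col B \<longrightarrow>
     (let m = dim_col B; p = m div 2; LL = fst (LUR F (left_half B)) in
        entries_le (lur_b F LL B - exact_inv (blk LL 0 p 0 p) * blk B 0 p p m) e))"

lemma step_b_error_le_call:
  "step_b_error_le F A e \<Longrightarrow> B \<in> LUR_calls F A \<Longrightarrow> step_b_error_le F B e"
  unfolding step_b_error_le_def by (meson LUR_calls_trans)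

lemma step_b_error_le_mono: "step_b_error_le F A e \<Longrightarrow> e \<le> e' \<Longrightarrow> step_b_error_le F A e'"
  unfolding step_b_error_le_def Let_def by (meson entries_le_mono)

lemma LUR_calls_carrier:
  assumes "B \<in> LUR_calls F A" "A \<in> carrier_mat n m" "1 \<le> m" "m \<le> n"
  shows "1 \<le> dim_col B \<and> dim_col B \<le> dim_row B \<and> dim_row B \<le> n"
  using assms by (induction rule: LUR_calls.induct) auto

lemma fl_tri_inv_carrier:
  assumes "T \<in> carrier_mat n n"
  shows "fl_tri_inv F T \<in> carrier_mat n n"
proof -
  have "dim_row (fl_tri_inv F T) = dim_row T \<and> dim_col (fl_tri_inv F T) = dim_row T"
  proof (induction F T rule: fl_tri_inv.induct)
    case (1 F T)
    show ?case
    proof (cases "dim_row T \<le> 1")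
      case False
      then show ?thesis
        using 1[OF refl refl] by (subst (1 2) fl_tri_inv.simps) (simp add: Let_def)
    qed (subst (1 2) fl_tri_inv.simps, simp add: Let_def)
  qed
  then show ?thesis using assms by auto
qed

section \<open>Backward error of the recursion\<close>

text \<open>One arithmetic with one fixed \<open>\<epsilon>\<close>.  The constant \<open>M\<close> and the bound \<open>n\<close> on all dimensions
  are parameters, and the error constants below are explicit functions of them: this is what makes
  the final constant the same for all \<open>\<epsilon>\<close>.\<close>

locale rounded_arith =
  fixes F :: fp_arith and \<epsilon> :: real and n :: nat and M :: real
  assumes eps: "0 < \<epsilon>" "\<epsilon> \<le> 1/2"
    and sub_rounded: "\<exists>\<delta>. \<bar>\<delta>\<bar> \<le> \<epsilon> \<and> fl_sub F x y = (x - y) * (1 + \<delta>)"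
    and div_rounded: "y \<noteq> 0 \<Longrightarrow> \<exists>\<delta>. \<bar>\<delta>\<bar> \<le> \<epsilon> \<and> fl_div F x y = x / y * (1 + \<delta>)"
    and M_nonneg: "0 \<le> M"
    and mm_rounded: "0 < r \<Longrightarrow> r \<le> n \<Longrightarrow> 0 < k \<Longrightarrow> k \<le> n \<Longrightarrow> 0 < s \<Longrightarrow> s \<le> n \<Longrightarrow>
      A \<in> carrier_mat r k \<Longrightarrow> B \<in> carrier_mat k s \<Longrightarrow> fl_mm F A B \<in> carrier_mat r s"
      "0 < r \<Longrightarrow> r \<le> n \<Longrightarrow> 0 < k \<Longrightarrow> k \<le> n \<Longrightarrow> 0 < s \<Longrightarrow> s \<le> n \<Longrightarrow>
      A \<in> carrier_mat r k \<Longrightarrow> B \<in> carrier_mat k s \<Longrightarrow> 0 \<le> a \<Longrightarrow> 0 \<le> b \<Longrightarrow>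
      entries_le A a \<Longrightarrow> entries_le B b \<Longrightarrow>
      entries_le (fl_mm F A B - A * B) (M * \<epsilon> * a * b)"
begin

text \<open>The entries of \<open>L\<close> on and below the diagonal arise as quotients in the single columns at the
  leaves of the recursion, where the pivot order makes the exact quotient at most \<open>1\<close> in modulus, and on the diagonal
  equal to \<open>1\<close>.  Rounding costs a factor between \<open>1 - \<epsilon>\<close> and \<open>1 + \<epsilon>\<close>.\<close>

lemma LUR_shape:
  assumes "A \<in> carrier_mat r m" "1 \<le> m" "m \<le> r" "correct_pivot_order F A" "LUR F A = (L, U)"
  shows "L \<in> carrier_mat r m" "U \<in> carrier_mat m m" "lower_pivotal L" "entries_le L 2"
proof -
  have "L \<in> carrier_mat r m \<and> U \<in> carrier_mat m m \<and> lower_pivotal L \<and> entries_le L 2"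
    using assms
  proof (induction m arbitrary: r A L U rule: less_induct)
    case (less m)
    show ?case
    proof (cases "m = 1")
      case True
      have A1: "A \<in> carrier_mat r 1" using less.prems True by simp
      have piv: "A $$ (0, 0) \<noteq> 0" "\<And>i. i < r \<Longrightarrow> \<bar>A $$ (i, 0)\<bar> \<le> \<bar>A $$ (0, 0)\<bar>"
        using less.prems(4) LUR_calls.top[of A F] A1 by (auto simp: correct_pivot_order_def)
      have L: "L = mat r 1 (\<lambda>(i, j). fl_div F (A $$ (i, 0)) (A $$ (0, 0)))" and U: "U \<in> carrier_mat 1 1"
        using less.prems(5) LUR_simps_1[OF A1] by auto
      have ent: "\<bar>fl_div F (A $$ (i, 0)) (A $$ (0, 0))\<bar> \<le> 2" if "i < r" for i
      proof -
        obtain d where d: "\<bar>d\<bar> \<le> \<epsilon>"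
          "fl_div F (A $$ (i, 0)) (A $$ (0, 0)) = A $$ (i, 0) / A $$ (0, 0) * (1 + d)"
          using div_rounded[OF piv(1)] by blast
        have "\<bar>A $$ (i, 0) / A $$ (0, 0)\<bar> \<le> 1" using piv that by (simp add: divide_le_eq)
        moreover have "\<bar>1 + d\<bar> \<le> 2" using d(1) eps by linarith
        ultimately have "\<bar>A $$ (i, 0) / A $$ (0, 0)\<bar> * \<bar>1 + d\<bar> \<le> 1 * 2" by (intro mult_mono) auto
        then show ?thesis unfolding d(2) abs_mult by simp
      qed
      obtain d where d: "\<bar>d\<bar> \<le> \<epsilon>"
        "fl_div F (A $$ (0, 0)) (A $$ (0, 0)) = A $$ (0, 0) / A $$ (0, 0) * (1 + d)"
        using div_rounded[OF piv(1)] by blast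
      have "1/2 \<le> fl_div F (A $$ (0, 0)) (A $$ (0, 0))"
        using d piv(1) eps by simp
      then show ?thesis
        using ent U True less.prems(2,3) by (auto simp: L lower_pivotal_def entries_le_def)
    next
      case False
      define p where "p = m div 2"
      have p: "1 \<le> p" "p < m" "1 \<le> m - p" "m - p < m" using False less.prems(2) by (auto simp: p_def)
      obtain LL UL where LL: "LUR F (left_half A) = (LL, UL)" by fastforce
      obtain LR UR where LR: "LUR F (lur_c F LL A) = (LR, UR)" by fastforce
      have calls: "left_half A \<in> LUR_calls F A" "lur_c F LL A \<in> LUR_calls F A"
        using LUR_calls.left[OF LUR_calls.top[of A F]] LUR_calls.right[OF LUR_calls.top[of A F]]
          less.prems(1) p LL by auto
      have IHL: "LL \<in> carrier_mat r p \<and> UL \<in> carrier_mat p p \<and> lower_pivotal LL \<and> entries_le LL 2"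
        by (rule less.IH[OF p(2) _ p(1) _ correct_pivot_order_call[OF less.prems(4) calls(1)] LL])
          (use less.prems p in \<open>auto simp: p_def\<close>)
      have IHR: "LR \<in> carrier_mat (r - p) (m - p) \<and> UR \<in> carrier_mat (m - p) (m - p)
          \<and> lower_pivotal LR \<and> entries_le LR 2"
        by (rule less.IH[OF p(4) _ p(3) _ correct_pivot_order_call[OF less.prems(4) calls(2)] LR])
          (use less.prems p in \<open>auto simp: p_def\<close>)
      have LU: "L = four_block_mat (blk LL 0 p 0 p) (0\<^sub>m p (m - p)) (blk LL p r 0 p) LR"
        "U = four_block_mat UL (lur_b F LL A) (0\<^sub>m (m - p) p) UR"
        using LUR_simps_rec[OF less.prems(1) _ p_def LL LR] less.prems(5) p by auto
      have "L \<in> carrier_mat r m" "U \<in> carrier_mat m m"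
        using IHL IHR p less.prems(3) by (auto simp: LU)
      moreover have "lower_pivotal L"
        using IHL IHR p less.prems(3) by (auto simp: LU lower_pivotal_def blk_def)
      moreover have "entries_le L 2"
        using IHL IHR p less.prems(3) by (auto simp: LU entries_le_def blk_def)
      ultimately show ?thesis by blast
    qed
  qed
  then show "L \<in> carrier_mat r m" "U \<in> carrier_mat m m" "lower_pivotal L" "entries_le L 2" by auto
qed

text \<open>If the entries of the current matrix are at most \<open>a\<close>, then \<open>solve_growth c * a\<close> bounds the
  result of step (b), \<open>schur_growth c * a\<close> that of step (c), and \<open>schur_error c * \<epsilon> * a\<close> the
  rounding error committed in step (c).\<close>

definition solve_growth :: "real \<Rightarrow> real" where
  "solve_growth c = 2 * 5 ^ n + c"

definition schur_growth :: "real \<Rightarrow> real" where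
  "schur_growth c = 2 * (1 + 2 * (real n + M) * solve_growth c)"

definition schur_error :: "real \<Rightarrow> real" where
  "schur_error c = schur_growth c / 2 + 2 * M * solve_growth c"

text \<open>A closed form that dominates the recursion for the backward error.  At each level the second
  call works on a matrix larger by the factor \<open>schur_growth c\<close>, and the local errors add at most
  \<open>2 * n * c\<close> or \<open>schur_error c\<close>; the summand \<open>1\<close> accounts for the division in a single column.\<close>

definition backward_const :: "real \<Rightarrow> nat \<Rightarrow> real" where
  "backward_const c m = (1 + 2 * real n * c + schur_error c) * (1 + schur_growth c) ^ m"

lemma schur_growth_ge_1: "0 \<le> c \<Longrightarrow> 1 \<le> schur_growth c"
  using M_nonneg by (simp add: schur_growth_def solve_growth_def)

lemma schur_error_nonneg: "0 \<le> c \<Longrightarrow> 0 \<le> schur_error c"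
  using M_nonneg schur_growth_ge_1[of c] by (simp add: schur_error_def solve_growth_def)

lemma backward_const_step:
  assumes c: "0 \<le> c" and "p < m" "0 < p"
  shows "backward_const c p \<le> backward_const c m"
    and "2 * real n * c \<le> backward_const c m"
    and "schur_error c + backward_const c (m - p) * schur_growth c \<le> backward_const c m"
proof -
  define g where "g = schur_growth c"
  define s where "s = 1 + 2 * real n * c + schur_error c"
  have g: "1 \<le> g" using schur_growth_ge_1[OF c] by (simp add: g_def)
  have s: "0 \<le> 2 * real n * c" "0 \<le> schur_error c" "0 \<le> s"
    using c schur_error_nonneg[OF c] by (auto simp: s_def)
  have K: "backward_const c k = s * (1 + g) ^ k" for k
    by (simp add: backward_const_def s_def g_def)
  have K_mono: "backward_const c k \<le> backward_const c l" if "k \<le> l" for k l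
    unfolding K using that g s by (intro mult_left_mono power_increasing) auto
  have K_ge: "s \<le> backward_const c k" for k
    using K_mono[of 0 k] by (simp add: K)
  show "backward_const c p \<le> backward_const c m" using K_mono assms by simp
  have "2 * real n * c \<le> s" "schur_error c \<le> s"
    using s(1,2) unfolding s_def by linarith+
  then have K_ge': "2 * real n * c \<le> backward_const c k" "schur_error c \<le> backward_const c k" for k
    using K_ge[of k] by linarith+
  show "2 * real n * c \<le> backward_const c m" by (rule K_ge')
  have "schur_error c + backward_const c (m - p) * g \<le> backward_const c (m - p) * (1 + g)"
    using K_ge'(2)[of "m - p"] by (simp add: distrib_left)
  also have "\<dots> = backward_const c (Suc (m - p))" by (simp add: K)
  also have "\<dots> \<le> backward_const c m" using assms by (intro K_mono) auto
  finally show "schur_error c + backward_const c (m - p) * schur_growth c \<le> backward_const c m"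
    by (simp add: g_def)
qed

lemma backward_const_ge_1:
  assumes "0 \<le> c"
  shows "1 \<le> backward_const c m"
proof -
  have "1 * 1 \<le> (1 + 2 * real n * c + schur_error c) * (1 + schur_growth c) ^ m"
    using assms schur_error_nonneg[OF assms] schur_growth_ge_1[OF assms]
    by (intro mult_mono one_le_power) auto
  then show ?thesis by (simp add: backward_const_def)
qed

text \<open>One level of the recursion, with \<open>T\<close>, \<open>L\<^sub>2\<^sub>1\<close> the two parts of the computed \<open>L\<^sub>L\<close> and \<open>X\<close> the
  computed block of step (b).  Let \<open>Y\<close> be the exact result of step (b).  Then
  \<open>T \<cdot> X - A\<^sub>1\<^sub>2 = T \<cdot> (X - Y)\<close> is small because \<open>X - Y\<close> is, and \<open>X\<close> is bounded because \<open>Y\<close> is.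
  In step (c) an entry of the result is \<open>w (1 + \<delta>)\<close> with \<open>w\<close> the exact difference of \<open>A\<^sub>2\<^sub>2\<close> and the
  computed product \<open>Z\<close>, which leaves the error \<open>w \<delta> - (Z - L\<^sub>2\<^sub>1 \<cdot> X)\<close>.\<close>

lemma recursion_step_bounds:
  fixes a c :: real
  assumes A: "A \<in> carrier_mat r m" and m: "1 < m" "m \<le> r" "r \<le> n" and p: "p = m div 2"
    and LL: "LL \<in> carrier_mat r p" "lower_pivotal LL" "entries_le LL 2"
    and a: "entries_le A a" "0 \<le> a" and c: "0 \<le> c"
    and err: "entries_le (lur_b F LL A - exact_inv (blk LL 0 p 0 p) * blk A 0 p p m) (c * \<epsilon> * a)"
  shows "lur_b F LL A \<in> carrier_mat p (m - p)"
    and "entries_le (blk LL 0 p 0 p * lur_b F LL A - blk A 0 p p m) (2 * real n * c * \<epsilon> * a)"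
    and "entries_le (lur_c F LL A) (schur_growth c * a)"
    and "entries_le (blk LL p r 0 p * lur_b F LL A + lur_c F LL A - blk A p r p m)
           (schur_error c * \<epsilon> * a)"
proof -
  define T where "T = blk LL 0 p 0 p"
  define L21 where "L21 = blk LL p r 0 p"
  define B12 where "B12 = blk A 0 p p m"
  define B22 where "B22 = blk A p r p m"
  define X where "X = lur_b F LL A"
  define Y where "Y = exact_inv T * B12"
  define Z where "Z = fl_mm F L21 X"
  have dims: "0 < p" "p < m" "p \<le> n" "0 < m - p" "m - p \<le> n" "0 < r - p" "r - p \<le> n" "p \<le> r"
    using m p by auto
  have carr: "T \<in> carrier_mat p p" "L21 \<in> carrier_mat (r - p) p"
    "B12 \<in> carrier_mat p (m - p)" "B22 \<in> carrier_mat (r - p) (m - p)"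
    by (auto simp: T_def L21_def B12_def B22_def blk_def)
  have T: "lower_pivotal T" "entries_le T 2" and L21: "entries_le L21 2"
    using LL dims by (auto simp: T_def L21_def blk_def lower_pivotal_def entries_le_def)
  have B: "entries_le B12 a" "entries_le B22 a"
    using A a dims m by (auto simp: B12_def B22_def intro!: entries_le_blk)
  have X_eq: "X = fl_mm F (fl_tri_inv F T) B12"
    using A by (simp add: X_def lur_b_def T_def B12_def Let_def p)
  have X: "X \<in> carrier_mat p (m - p)"
    unfolding X_eq by (rule mm_rounded) (use dims carr fl_tri_inv_carrier in auto)
  then show "lur_b F LL A \<in> carrier_mat p (m - p)" by (simp add: X_def)
  note inv = lower_pivotal_exact_inv[OF carr(1) T(1)]
  have Y: "Y \<in> carrier_mat p (m - p)"
    using inv carr by (auto simp: Y_def)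
  have TY: "T * Y = B12"
    using inv carr by (simp add: Y_def assoc_mult_mat[symmetric, of T p p "exact_inv T" p B12 "m - p"])
  have E: "X - Y \<in> carrier_mat p (m - p)" "entries_le (X - Y) (c * \<epsilon> * a)"
    using minus_carrier_mat[OF Y, of X] err by (simp_all add: X_def Y_def T_def B12_def)
  have cea: "0 \<le> c * \<epsilon> * a" using c eps a by simp
  have "entries_le (T * (X - Y)) (real p * 2 * (c * \<epsilon> * a))"
    using entries_le_mult[OF carr(1) E(1) T(2) E(2)] by simp
  moreover have "T * (X - Y) = T * X - B12"
    using mult_minus_distrib_mat[OF carr(1) X Y] TY by simp
  moreover have "real p * 2 * (c * \<epsilon> * a) \<le> real n * 2 * (c * \<epsilon> * a)"
    using dims cea by (intro mult_right_mono) auto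
  ultimately have "entries_le (T * X - B12) (2 * real n * c * \<epsilon> * a)"
    by (auto intro: entries_le_mono simp: algebra_simps)
  then show "entries_le (blk LL 0 p 0 p * lur_b F LL A - blk A 0 p p m) (2 * real n * c * \<epsilon> * a)"
    by (simp add: T_def X_def B12_def)
  have "entries_le Y (2 * 5 ^ p * a)"
    using forward_substitution_bound[OF carr(1) Y T] TY B(1) by simp
  from entries_le_add[OF Y E(1) this E(2)]
  have "entries_le X (2 * 5 ^ p * a + c * \<epsilon> * a)"
    using X Y by (auto simp: entries_le_def)
  moreover have "2 * 5 ^ p * a + c * \<epsilon> * a \<le> solve_growth c * a"
  proof -
    have "(5::real) ^ p \<le> 5 ^ n" using dims by (intro power_increasing) auto
    moreover have "c * \<epsilon> \<le> c * 1" using c eps by (intro mult_left_mono) auto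
    ultimately have "2 * 5 ^ p + c * \<epsilon> \<le> solve_growth c" unfolding solve_growth_def by linarith
    from mult_right_mono[OF this a(2)] show ?thesis by (simp add: distrib_right)
  qed
  ultimately have Xb: "entries_le X (solve_growth c * a)" by (rule entries_le_mono)
  define g where "g = solve_growth c * a"
  have g0: "0 \<le> g" using c a by (simp add: g_def solve_growth_def)
  note Xb = Xb[folded g_def]
  have Z: "Z \<in> carrier_mat (r - p) (m - p)"
    unfolding Z_def by (rule mm_rounded) (use dims carr X in auto)
  define V where "V = L21 * X"
  have V: "V \<in> carrier_mat (r - p) (m - p)" using carr X by (auto simp: V_def)
  have Zerr: "entries_le (Z - V) (M * \<epsilon> * 2 * g)"
    unfolding Z_def V_def by (rule mm_rounded) (use dims carr X L21 Xb g0 in auto)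
  have Vb: "entries_le (V) (real n * 2 * g)"
    unfolding V_def
  proof (rule entries_le_mono[OF entries_le_mult[OF carr(2) X L21 Xb]])
    show "real p * 2 * g \<le> real n * 2 * g" using dims g0 by (intro mult_right_mono) auto
  qed simp
  have Mg: "0 \<le> M * 2 * g" using M_nonneg g0 by simp
  have diff: "\<bar>B22 $$ (i, j) - Z $$ (i, j)\<bar> \<le> a + 2 * real n * g + 2 * M * g"
    "\<bar>Z $$ (i, j) - (V) $$ (i, j)\<bar> \<le> 2 * M * g * \<epsilon>"
    if ij: "i < r - p" "j < m - p" for i j
  proof -
    have "\<bar>Z $$ (i, j) - (V) $$ (i, j)\<bar> \<le> M * \<epsilon> * 2 * g"
      using entries_leD[OF Zerr, of i j] ij Z V by auto
    then show *: "\<bar>Z $$ (i, j) - (V) $$ (i, j)\<bar> \<le> 2 * M * g * \<epsilon>"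
      by (simp add: algebra_simps)
    have "M * 2 * g * \<epsilon> \<le> M * 2 * g * 1" using Mg eps by (intro mult_left_mono) auto
    moreover have "\<bar>B22 $$ (i, j)\<bar> \<le> a" using entries_leD[OF B(2), of i j] ij carr by auto
    moreover have "\<bar>(V) $$ (i, j)\<bar> \<le> real n * 2 * g" using entries_leD[OF Vb, of i j] ij V by auto
    ultimately show "\<bar>B22 $$ (i, j) - Z $$ (i, j)\<bar> \<le> a + 2 * real n * g + 2 * M * g"
      using * by (simp add: algebra_simps)
  qed
  have h: "a + 2 * real n * g + 2 * M * g = schur_growth c / 2 * a"
    by (simp add: g_def schur_growth_def algebra_simps)
  have C: "lur_c F LL A \<in> carrier_mat (r - p) (m - p)"
    using A p by (intro carrier_matI) auto
  have C_entry: "lur_c F LL A $$ (i, j) = fl_sub F (B22 $$ (i, j)) (Z $$ (i, j))"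
    if "i < r - p" "j < m - p" for i j
    using that A p carr by (simp add: lur_c_def Let_def fl_sub_mat_def B22_def Z_def L21_def X_def)
  have bounds: "\<bar>lur_c F LL A $$ (i, j)\<bar> \<le> schur_growth c * a \<and>
      \<bar>(V + lur_c F LL A - B22) $$ (i, j)\<bar> \<le> schur_error c * \<epsilon> * a"
    if ij: "i < r - p" "j < m - p" for i j
  proof -
    define w where "w = B22 $$ (i, j) - Z $$ (i, j)"
    obtain \<delta> where \<delta>: "\<bar>\<delta>\<bar> \<le> \<epsilon>" "lur_c F LL A $$ (i, j) = w * (1 + \<delta>)"
      using sub_rounded C_entry[OF ij] by (metis w_def)
    have w: "\<bar>w\<bar> \<le> schur_growth c / 2 * a" using diff(1)[OF ij] by (simp add: w_def h)
    have "\<bar>w\<bar> * \<bar>1 + \<delta>\<bar> \<le> (schur_growth c / 2 * a) * 2"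
      using w \<delta>(1) eps by (intro mult_mono) auto
    then have 1: "\<bar>lur_c F LL A $$ (i, j)\<bar> \<le> schur_growth c * a"
      by (simp add: \<delta>(2) abs_mult)
    have "\<bar>w\<bar> * \<bar>\<delta>\<bar> \<le> (schur_growth c / 2 * a) * \<epsilon>"
      using w \<delta>(1) by (intro mult_mono) auto
    then have "\<bar>w * \<delta>\<bar> \<le> schur_growth c / 2 * a * \<epsilon>" by (simp add: abs_mult)
    moreover have "(V + lur_c F LL A - B22) $$ (i, j)
        = w * \<delta> - (Z $$ (i, j) - (V) $$ (i, j))"
    proof -
      have "(V + lur_c F LL A - B22) $$ (i, j)
        = (V) $$ (i, j) + lur_c F LL A $$ (i, j) - B22 $$ (i, j)"
        using ij carrier_matD[OF C] carrier_matD[OF V] carrier_matD[OF carr(4)] by simp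
      then show ?thesis by (simp add: \<delta>(2) w_def algebra_simps)
    qed
    ultimately have "\<bar>(V + lur_c F LL A - B22) $$ (i, j)\<bar>
        \<le> schur_growth c / 2 * a * \<epsilon> + 2 * M * g * \<epsilon>"
      using diff(2)[OF ij] by linarith
    then show ?thesis using 1 by (simp add: schur_error_def g_def algebra_simps)
  qed
  show "entries_le (lur_c F LL A) (schur_growth c * a)"
    using bounds unfolding entries_le_def carrier_matD[OF C] by blast
  show "entries_le (blk LL p r 0 p * lur_b F LL A + lur_c F LL A - blk A p r p m)
           (schur_error c * \<epsilon> * a)"
    unfolding entries_le_def L21_def[symmetric] X_def[symmetric] B22_def[symmetric] V_def[symmetric]
    using bounds carr(4) by auto
qed

text \<open>The bound \<open>a\<close> on the entries must be arbitrary in the induction: the second recursive call is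
  made on a Schur complement that satisfies only the weaker bound \<open>a' = schur_growth c * a\<close>.  The
  error allowed in step (b) does not change from level to level, hence is still at most
  \<open>c * \<epsilon> * a'\<close>.\<close>

theorem LUR_backward_error:
  fixes a c :: real
  assumes "A \<in> carrier_mat r m" "1 \<le> m" "m \<le> r" "r \<le> n"
    and "correct_pivot_order F A" "LUR F A = (L, U)"
    and "entries_le A a" "0 \<le> a" "0 \<le> c" "step_b_error_le F A (c * \<epsilon> * a)"
  shows "entries_le (L * U - A) (backward_const c m * \<epsilon> * a)"
  using assms
proof (induction m arbitrary: r A L U a rule: less_induct)
  case (less m)
  note sg = schur_growth_ge_1[OF less.prems(9)]
  have ea: "0 \<le> \<epsilon> * a" using eps less.prems by simp
  show ?case
  proof (cases "m = 1")
    case True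
    have A1: "A \<in> carrier_mat r 1" using less.prems True by simp
    have piv: "A $$ (0, 0) \<noteq> 0"
      using less.prems(5) LUR_calls.top[of A F] A1 by (auto simp: correct_pivot_order_def)
    have L: "L = mat r 1 (\<lambda>(i, j). fl_div F (A $$ (i, 0)) (A $$ (0, 0)))"
      and U: "U = mat 1 1 (\<lambda>_. A $$ (0, 0))"
      using less.prems(6) LUR_simps_1[OF A1] by auto
    have "\<bar>(L * U - A) $$ (i, 0)\<bar> \<le> backward_const c m * \<epsilon> * a" if "i < r" for i
    proof -
      obtain d where d: "\<bar>d\<bar> \<le> \<epsilon>"
        "fl_div F (A $$ (i, 0)) (A $$ (0, 0)) = A $$ (i, 0) / A $$ (0, 0) * (1 + d)"
        using div_rounded[OF piv] by blast
      have "(L * U - A) $$ (i, 0) = d * A $$ (i, 0)"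
        using that A1 piv by (simp add: L U scalar_prod_def d(2) field_simps)
      then have "\<bar>(L * U - A) $$ (i, 0)\<bar> \<le> \<epsilon> * a"
        using d(1) entries_leD[OF less.prems(7), of i 0] A1 that
        by (auto simp: abs_mult intro!: mult_mono)
      moreover have "1 * (\<epsilon> * a) \<le> backward_const c m * (\<epsilon> * a)"
        using ea backward_const_ge_1[OF less.prems(9)] by (intro mult_right_mono)
      ultimately show ?thesis by (simp add: mult.assoc)
    qed
    then show ?thesis using A1 by (auto simp: entries_le_def)
  next
    case False
    define p where "p = m div 2"
    have p: "1 \<le> p" "p < m" "1 \<le> m - p" "m - p < m" "p \<le> r"
      using False less.prems(2,3) by (auto simp: p_def)
    obtain LL UL where LL: "LUR F (left_half A) = (LL, UL)" by fastforce
    obtain LR UR where LR: "LUR F (lur_c F LL A) = (LR, UR)" by fastforce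
    have calls: "left_half A \<in> LUR_calls F A" "lur_c F LL A \<in> LUR_calls F A"
      using LUR_calls.left[OF LUR_calls.top[of A F]] LUR_calls.right[OF LUR_calls.top[of A F]]
        less.prems(1) p LL by auto
    have lh: "left_half A \<in> carrier_mat r p" using less.prems(1) by (auto simp: p_def)
    have lc: "lur_c F LL A \<in> carrier_mat (r - p) (m - p)" using less.prems(1) by (auto simp: p_def)
    have rp: "m - p \<le> r - p" "p \<le> r" "r - p \<le> n" using less.prems p by auto
    note pivL = correct_pivot_order_call[OF less.prems(5) calls(1)]
    note pivR = correct_pivot_order_call[OF less.prems(5) calls(2)]
    note shL = LUR_shape[OF lh p(1) rp(2) pivL LL]
    note shR = LUR_shape[OF lc p(3) rp(1) pivR LR]
    define T where "T = blk LL 0 p 0 p"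
    define L21 where "L21 = blk LL p r 0 p"
    define X where "X = lur_b F LL A"
    have LU: "L = four_block_mat T (0\<^sub>m p (m - p)) L21 LR" "U = four_block_mat UL X (0\<^sub>m (m - p) p) UR"
      using LUR_simps_rec[OF less.prems(1) _ p_def LL LR] less.prems(6) p
      by (auto simp: T_def L21_def X_def)
    have carr: "T \<in> carrier_mat p p" "L21 \<in> carrier_mat (r - p) p"
      by (auto simp: T_def L21_def blk_def)
    have m1: "1 < m" using p by simp
    have err: "entries_le (lur_b F LL A - exact_inv (blk LL 0 p 0 p) * blk A 0 p p m) (c * \<epsilon> * a)"
      using less.prems(1,10) LUR_calls.top[of A F] m1
      unfolding step_b_error_le_def by (force simp: Let_def LL p_def)
    note step = recursion_step_bounds[OF less.prems(1) m1 less.prems(3,4) p_def shL(1,3,4)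
      less.prems(7,8,9) err, folded T_def L21_def X_def]
    have X: "X \<in> carrier_mat p (m - p)" by (rule step(1))
    define a' where "a' = schur_growth c * a"
    have aa': "a \<le> a'" by (use mult_right_mono[OF sg less.prems(8)] in \<open>simp add: a'_def\<close>)
    have a'0: "0 \<le> a'" using aa' less.prems(8) by simp
    have e': "c * \<epsilon> * a \<le> c * \<epsilon> * a'" using aa' less.prems(9) eps by (intro mult_left_mono) auto
    have left: "entries_le (LL * UL - left_half A) (backward_const c p * \<epsilon> * a)"
      by (rule less.IH[OF p(2) lh p(1) rp(2) less.prems(4) pivL LL _ less.prems(8,9)
            step_b_error_le_call[OF less.prems(10) calls(1)]])
        (use less.prems(1,7) in \<open>auto simp: left_half_def intro!: entries_le_blk\<close>)
    have stepR: "step_b_error_le F (lur_c F LL A) (c * \<epsilon> * a')"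
      by (rule step_b_error_le_mono[OF step_b_error_le_call[OF less.prems(10) calls(2)] e'])
    have right: "entries_le (LR * UR - lur_c F LL A) (backward_const c (m - p) * \<epsilon> * a')"
      by (rule less.IH[OF p(4) lc p(3) rp(1,3) pivR LR step(3)[folded a'_def] a'0 less.prems(9) stepR])
    have const_bounds: "backward_const c p * \<epsilon> * a \<le> backward_const c m * \<epsilon> * a"
      "2 * real n * c * \<epsilon> * a \<le> backward_const c m * \<epsilon> * a"
      "schur_error c * \<epsilon> * a + backward_const c (m - p) * \<epsilon> * a' \<le> backward_const c m * \<epsilon> * a"
    proof -
      have "p < m" "0 < p" using p by auto
      note bc = backward_const_step[OF less.prems(9) this]
      show "backward_const c p * \<epsilon> * a \<le> backward_const c m * \<epsilon> * a"
        using mult_right_mono[OF bc(1) ea] by (simp only: mult.assoc)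
      show "2 * real n * c * \<epsilon> * a \<le> backward_const c m * \<epsilon> * a"
        using mult_right_mono[OF bc(2) ea] by (simp only: mult.assoc)
      have "schur_error c * \<epsilon> * a + backward_const c (m - p) * \<epsilon> * a'
          = (schur_error c + backward_const c (m - p) * schur_growth c) * (\<epsilon> * a)"
        by (simp add: a'_def algebra_simps)
      also have "\<dots> \<le> backward_const c m * (\<epsilon> * a)"
        by (rule mult_right_mono[OF bc(3) ea])
      finally show "schur_error c * \<epsilon> * a + backward_const c (m - p) * \<epsilon> * a'
          \<le> backward_const c m * \<epsilon> * a"
        by (simp only: mult.assoc)
    qed
    have LUprod: "L * U = four_block_mat (T * UL) (T * X) (L21 * UL) (L21 * X + LR * UR)"
    proof -
      have "L * U = four_block_mat (T * UL + 0\<^sub>m p (m - p) * 0\<^sub>m (m - p) p) (T * X + 0\<^sub>m p (m - p) * UR)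
         (L21 * UL + LR * 0\<^sub>m (m - p) p) (L21 * X + LR * UR)"
        unfolding LU by (rule mult_four_block_mat[OF carr(1) _ carr(2) shR(1) shL(2) X _ shR(2)]) auto
      then show ?thesis using carr shL shR X by simp
    qed
    have "T * UL = blk (LL * UL) 0 p 0 p" "L21 * UL = blk (LL * UL) p r 0 p"
      using shL p by (auto simp: T_def L21_def blk_mult_right)
    note LUprod = LUprod[unfolded this]
    have "\<bar>(L * U - A) $$ (i, j)\<bar> \<le> backward_const c m * \<epsilon> * a" if ij: "i < r" "j < m" for i j
    proof -
      have sub: "(L * U - A) $$ (i, j) = (L * U) $$ (i, j) - A $$ (i, j)"
        using less.prems(1) ij by simp
      consider "j < p" | "p \<le> j" "i < p" | "p \<le> j" "p \<le> i" by linarith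
      then show ?thesis
      proof cases
        case 1
        have "(L * U - A) $$ (i, j) = (LL * UL - left_half A) $$ (i, j)"
          unfolding sub LUprod using 1 ij p shL shR X carr lh less.prems(1)
          by (auto simp: blk_def left_half_def p_def[symmetric])
        moreover have "\<bar>(LL * UL - left_half A) $$ (i, j)\<bar> \<le> backward_const c p * \<epsilon> * a"
          by (rule entries_leD[OF left]) (use 1 ij carrier_matD[OF lh] in simp_all)
        ultimately show ?thesis using const_bounds(1) by linarith
      next
        case 2
        have "(L * U - A) $$ (i, j) = (T * X - blk A 0 p p m) $$ (i, j - p)"
          unfolding sub LUprod using 2 ij p shL shR X carr less.prems(1)
          by (auto simp: blk_def simp del: index_mult_mat(1))
        moreover have "\<bar>(T * X - blk A 0 p p m) $$ (i, j - p)\<bar> \<le> 2 * real n * c * \<epsilon> * a"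
          by (rule entries_leD[OF step(2)]) (use 2 ij in simp_all)
        ultimately show ?thesis using const_bounds(2) by linarith
      next
        case 3
        have "(L * U - A) $$ (i, j) = (L21 * X + lur_c F LL A - blk A p r p m) $$ (i - p, j - p)
            + (LR * UR - lur_c F LL A) $$ (i - p, j - p)"
          unfolding sub LUprod using 3 ij p shL shR X carr lc less.prems(1)
          by (auto simp: blk_def simp del: index_mult_mat(1))
        moreover have "\<bar>(L21 * X + lur_c F LL A - blk A p r p m) $$ (i - p, j - p)\<bar> \<le> schur_error c * \<epsilon> * a"
          by (rule entries_leD[OF step(4)]) (use 3 ij in simp_all)
        moreover have "\<bar>(LR * UR - lur_c F LL A) $$ (i - p, j - p)\<bar> \<le> backward_const c (m - p) * \<epsilon> * a'"
          by (rule entries_leD[OF right]) (use 3 ij carrier_matD[OF lc] in simp_all)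
        ultimately show ?thesis using const_bounds(3) by linarith
      qed
    qed
    then show ?thesis using less.prems(1) by (auto simp: entries_le_def)
  qed
qed

end

section \<open>From norms to entries and back\<close>

text \<open>For each dimension the model gives its own \<open>\<nu>\<close> and its own range of \<open>\<epsilon>\<close>.  Only finitely many
  dimensions occur, so that one constant and one range serve all of them; restricting to
  \<open>\<epsilon> \<le> 1/2\<close> also absorbs the quadratic term into the linear one.\<close>

lemma rounded_arith_uniform:
  assumes N: "matrix_norm N" and F: "stable_matmul N \<mu> F" and std: "standard_fp_model F"
  shows "\<exists>M. \<exists>e>0. \<forall>\<epsilon>>0. \<epsilon> \<le> e \<longrightarrow> rounded_arith (F \<epsilon>) \<epsilon> n M"
proof -
  obtain C where C: "0 \<le> C"
    "\<And>r k A. r \<le> n \<Longrightarrow> k \<le> n \<Longrightarrow> A \<in> carrier_mat r k \<Longrightarrow> entries_le A (C * N A)"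
    "\<And>r k A a. r \<le> n \<Longrightarrow> k \<le> n \<Longrightarrow> A \<in> carrier_mat r k \<Longrightarrow> 0 \<le> a \<Longrightarrow> entries_le A a \<Longrightarrow> N A \<le> C * a"
    using matrix_norm_entries_uniform[OF N, of n] by blast
  define stable where "stable d \<nu> e \<longleftrightarrow> (\<forall>\<epsilon> r k s A B.
      0 < \<epsilon> \<longrightarrow> \<epsilon> \<le> e \<longrightarrow> 0 < r \<longrightarrow> 0 < k \<longrightarrow> 0 < s \<longrightarrow> max r (max k s) = d \<longrightarrow>
      A \<in> carrier_mat r k \<longrightarrow> B \<in> carrier_mat k s \<longrightarrow>
      fl_mm (F \<epsilon>) A B \<in> carrier_mat r s \<and>
      N (fl_mm (F \<epsilon>) A B - A * B) \<le> \<mu> d * \<epsilon> * N A * N B + \<nu> * \<epsilon>\<^sup>2 * N A * N B)" for d \<nu> e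
  have "\<forall>d. \<exists>\<nu>. \<exists>e>0. stable d \<nu> e"
    using F unfolding stable_matmul_def stable_def .
  then obtain \<nu> e where e: "\<And>d. 0 < e d" and stable: "\<And>d. stable d (\<nu> d) (e d)"
    by metis
  define e0 where "e0 = min (1/2) (Min (e ` {..n}))"
  have e0: "0 < e0" "e0 \<le> 1/2" "\<And>d. d \<le> n \<Longrightarrow> e0 \<le> e d"
    using e by (auto simp: e0_def min.coboundedI2)
  define D where "D = (\<Sum>d\<le>n. \<bar>\<mu> d\<bar> + \<bar>\<nu> d\<bar>)"
  have D: "\<bar>\<mu> d\<bar> + \<bar>\<nu> d\<bar> \<le> D" if "d \<le> n" for d
    unfolding D_def using that by (intro member_le_sum[of d _ "\<lambda>d. \<bar>\<mu> d\<bar> + \<bar>\<nu> d\<bar>"]) auto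
  have D0: "0 \<le> D" unfolding D_def by (intro sum_nonneg) auto
  have mm: "fl_mm (F \<epsilon>) A B \<in> carrier_mat r s \<and>
      (\<forall>a\<ge>0. \<forall>b\<ge>0. entries_le A a \<longrightarrow> entries_le B b \<longrightarrow>
        entries_le (fl_mm (F \<epsilon>) A B - A * B) (C * D * C * C * \<epsilon> * a * b))"
    if \<epsilon>: "0 < \<epsilon>" "\<epsilon> \<le> e0" and dims: "0 < r" "r \<le> n" "0 < k" "k \<le> n" "0 < s" "s \<le> n"
      and AB: "A \<in> carrier_mat r k" "B \<in> carrier_mat k s" for \<epsilon> r k s A B
  proof -
    define d where "d = max r (max k s)"
    have d: "d \<le> n" using dims by (simp add: d_def)
    have mmd: "fl_mm (F \<epsilon>) A B \<in> carrier_mat r s"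
      "N (fl_mm (F \<epsilon>) A B - A * B) \<le> \<mu> d * \<epsilon> * N A * N B + \<nu> d * \<epsilon>\<^sup>2 * N A * N B"
      using stable[of d, unfolded stable_def, rule_format,
          OF \<epsilon>(1) _ dims(1,3,5) d_def[symmetric] AB] e0(3)[OF d] \<epsilon>(2) by auto
    have NAB: "0 \<le> N A" "0 \<le> N B" using N AB unfolding matrix_norm_def by blast+
    have "\<mu> d * \<epsilon> + \<nu> d * \<epsilon>\<^sup>2 \<le> \<bar>\<mu> d\<bar> * \<epsilon> + \<bar>\<nu> d\<bar> * \<epsilon>"
    proof (rule add_mono)
      have "\<nu> d * \<epsilon>\<^sup>2 \<le> \<bar>\<nu> d\<bar> * \<epsilon>\<^sup>2" by (intro mult_right_mono) auto
      also have "\<epsilon>\<^sup>2 \<le> \<epsilon>" using \<epsilon> e0(2) by (simp add: power2_eq_square mult_left_le_one_le)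
      then have "\<bar>\<nu> d\<bar> * \<epsilon>\<^sup>2 \<le> \<bar>\<nu> d\<bar> * \<epsilon>" by (intro mult_left_mono) auto
      finally show "\<nu> d * \<epsilon>\<^sup>2 \<le> \<bar>\<nu> d\<bar> * \<epsilon>" .
    qed (use \<epsilon> in \<open>auto intro: mult_right_mono\<close>)
    also have "\<dots> \<le> D * \<epsilon>"
      using mult_right_mono[OF D[OF d], of \<epsilon>] \<epsilon> by (simp add: distrib_right)
    finally have "(\<mu> d * \<epsilon> + \<nu> d * \<epsilon>\<^sup>2) * (N A * N B) \<le> D * \<epsilon> * (N A * N B)"
      using NAB by (intro mult_right_mono) auto
    then have bound: "N (fl_mm (F \<epsilon>) A B - A * B) \<le> D * \<epsilon> * (N A * N B)"
      using mmd(2) by (simp add: algebra_simps)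
    have "entries_le (fl_mm (F \<epsilon>) A B - A * B) (C * D * C * C * \<epsilon> * a * b)"
      if ab: "0 \<le> a" "0 \<le> b" "entries_le A a" "entries_le B b" for a b
    proof -
      have "N A * N B \<le> (C * a) * (C * b)"
        using C(3)[OF _ _ AB(1)] C(3)[OF _ _ AB(2)] ab dims NAB C(1) by (intro mult_mono) auto
      then have "D * \<epsilon> * (N A * N B) \<le> D * \<epsilon> * ((C * a) * (C * b))"
        using D0 \<epsilon> by (intro mult_left_mono) auto
      then have "C * N (fl_mm (F \<epsilon>) A B - A * B) \<le> C * (D * \<epsilon> * ((C * a) * (C * b)))"
        using bound C(1) by (intro mult_left_mono) auto
      also have "\<dots> = C * D * C * C * \<epsilon> * a * b" by (simp add: algebra_simps)
      finally have le: "C * N (fl_mm (F \<epsilon>) A B - A * B) \<le> C * D * C * C * \<epsilon> * a * b" .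
      have "fl_mm (F \<epsilon>) A B - A * B \<in> carrier_mat r s"
        by (rule minus_carrier_mat[OF mult_carrier_mat[OF AB]])
      from entries_le_mono[OF C(2)[OF dims(2,6) this] le] show ?thesis .
    qed
    then show ?thesis using mmd(1) by blast
  qed
  have "rounded_arith (F \<epsilon>) \<epsilon> n (C * D * C * C)" if "0 < \<epsilon>" "\<epsilon> \<le> e0" for \<epsilon>
  proof
    show "0 \<le> C * D * C * C" using C(1) D0 by simp
  qed (use that e0(2) std mm[OF that] in \<open>auto simp: standard_fp_model_def\<close>)
  then show ?thesis using e0(1) by blast
qed

theorem lemma4p2:
  fixes N :: "real mat \<Rightarrow> real" and \<mu> :: "nat \<Rightarrow> real" and F :: "real \<Rightarrow> fp_arith"
    and n m :: nat and c \<kappa> \<kappa>' :: real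
  assumes "matrix_norm N"
    and "standard_fp_model F"
    and "polynomially_bounded \<mu>"
    and "stable_matmul N \<mu> F"
    and "1 \<le> m" and "m \<le> n"
  shows "\<exists>K. \<exists>\<epsilon>0>0. \<forall>\<epsilon> A L U.
    0 < \<epsilon> \<longrightarrow> \<epsilon> \<le> \<epsilon>0 \<longrightarrow>
    A \<in> carrier_mat n m \<longrightarrow>
    (L, U) = LUR (F \<epsilon>) A \<longrightarrow>
    correct_pivot_order (F \<epsilon>) A \<longrightarrow>
    sufficiently_well_conditioned N (F \<epsilon>) \<epsilon> c A \<longrightarrow>
    N L \<le> \<kappa> \<longrightarrow> N (exact_inv (blk L 0 m 0 m)) \<le> \<kappa>' \<longrightarrow>
    (\<exists>\<delta>A \<in> carrier_mat n m. L * U = A + \<delta>A \<and> N \<delta>A \<le> K * \<epsilon> * N A)"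
proof -
  obtain C where C: "0 \<le> C"
    "\<And>r k A. r \<le> n \<Longrightarrow> k \<le> n \<Longrightarrow> A \<in> carrier_mat r k \<Longrightarrow> entries_le A (C * N A)"
    "\<And>r k A a. r \<le> n \<Longrightarrow> k \<le> n \<Longrightarrow> A \<in> carrier_mat r k \<Longrightarrow> 0 \<le> a \<Longrightarrow> entries_le A a \<Longrightarrow> N A \<le> C * a"
    using matrix_norm_entries_uniform[OF assms(1), of n] by blast
  obtain M e where e: "0 < e"
    and arith: "\<And>\<epsilon>. 0 < \<epsilon> \<Longrightarrow> \<epsilon> \<le> e \<Longrightarrow> rounded_arith (F \<epsilon>) \<epsilon> n M"
    using rounded_arith_uniform[OF assms(1,4,2), of n] by blast
  \<comment> \<open>One factor \<open>C\<close> comes from bounding the entries of \<open>A\<close> by its norm, the other from bounding the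
    norm of the error by its entries.\<close>
  define K where "K = C * rounded_arith.backward_const n M \<bar>c\<bar> m * C"
  have "\<exists>\<delta>A \<in> carrier_mat n m. L * U = A + \<delta>A \<and> N \<delta>A \<le> K * \<epsilon> * N A"
    if \<epsilon>: "0 < \<epsilon>" "\<epsilon> \<le> e" and A: "A \<in> carrier_mat n m"
      and LU: "(L, U) = LUR (F \<epsilon>) A" and piv: "correct_pivot_order (F \<epsilon>) A"
      and wc: "sufficiently_well_conditioned N (F \<epsilon>) \<epsilon> c A" for \<epsilon> A L U
  proof -
    interpret rounded_arith "F \<epsilon>" \<epsilon> n M using arith \<epsilon> by blast
    have NA: "0 \<le> N A" using assms(1) A unfolding matrix_norm_def by blast
    define a where "a = C * N A"
    have a: "0 \<le> a" "entries_le A a" using C NA A assms(6) by (auto simp: a_def)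
    have wc': "step_b_error_le (F \<epsilon>) A (\<bar>c\<bar> * \<epsilon> * a)"
      unfolding step_b_error_le_def Let_def
    proof (intro ballI impI)
      fix B assume B: "B \<in> LUR_calls (F \<epsilon>) A" "1 < dim_col B"
      define p where "p = dim_col B div 2"
      define LL where "LL = fst (LUR (F \<epsilon>) (left_half B))"
      define T where "T = blk LL 0 p 0 p"
      define E where "E = lur_b (F \<epsilon>) LL B - exact_inv T * blk B 0 p p (dim_col B)"
      have dimB: "dim_col B \<le> dim_row B" "dim_row B \<le> n"
        using LUR_calls_carrier[OF B(1) A assms(5,6)] by auto
      have p: "1 \<le> p" "p \<le> dim_row B" "p \<le> n" using B(2) dimB by (auto simp: p_def)
      have lh: "left_half B \<in> carrier_mat (dim_row B) p" by (auto simp: p_def)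
      have piv': "correct_pivot_order (F \<epsilon>) (left_half B)"
        by (rule correct_pivot_order_call[OF piv LUR_calls.left[OF B]])
      have sh: "LL \<in> carrier_mat (dim_row B) p" "lower_pivotal LL"
        using LUR_shape[OF lh p(1,2) piv', of LL] by (auto simp: LL_def prod_eq_iff)
      then have "lower_pivotal T" using p by (auto simp: T_def lower_pivotal_def blk_def)
      then have "exact_inv T \<in> carrier_mat p p"
        by (intro lower_pivotal_exact_inv) (auto simp: T_def blk_def)
      \<comment> \<open>The equivalence of norms needs the shape of the error matrix, hence that of the inverse.\<close>
      then have E: "E \<in> carrier_mat p (dim_col B - p)" by (auto simp: E_def)
      have "N E \<le> c * \<epsilon> * N A"
        using wc B unfolding sufficiently_well_conditioned_def E_def T_def LL_def p_def Let_def by blast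
      also have "\<dots> \<le> \<bar>c\<bar> * \<epsilon> * N A" using \<epsilon> NA by (intro mult_right_mono) auto
      finally have "C * N E \<le> \<bar>c\<bar> * \<epsilon> * a"
        using C(1) by (auto simp: a_def mult.left_commute dest: mult_left_mono)
      moreover have "entries_le E (C * N E)"
        by (rule C(2)[OF _ _ E]) (use p dimB in auto)
      ultimately have "entries_le E (\<bar>c\<bar> * \<epsilon> * a)" using entries_le_mono by blast
      then show "entries_le (lur_b (F \<epsilon>) (fst (LUR (F \<epsilon>) (left_half B))) B -
          exact_inv (blk (fst (LUR (F \<epsilon>) (left_half B))) 0 (dim_col B div 2) 0 (dim_col B div 2)) *
          blk B 0 (dim_col B div 2) (dim_col B div 2) (dim_col B)) (\<bar>c\<bar> * \<epsilon> * a)"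
        by (simp add: E_def T_def LL_def p_def)
    qed
    note sh = LUR_shape[OF A assms(5,6) piv LU[symmetric]]
    have err: "entries_le (L * U - A) (backward_const \<bar>c\<bar> m * \<epsilon> * a)"
      by (rule LUR_backward_error[OF A assms(5,6) order.refl piv LU[symmetric] a(2,1) _ wc']) simp
    have K0: "0 \<le> backward_const \<bar>c\<bar> m * \<epsilon> * a"
      using backward_const_ge_1[of "\<bar>c\<bar>" m] \<epsilon> a by simp
    have carr: "L * U - A \<in> carrier_mat n m" using A by auto
    have "N (L * U - A) \<le> C * (backward_const \<bar>c\<bar> m * \<epsilon> * a)"
      by (rule C(3)[OF _ _ carr K0 err]) (use assms(6) in auto)
    then have "N (L * U - A) \<le> K * \<epsilon> * N A" by (simp add: K_def a_def mult.assoc mult.left_commute)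
    moreover have "L * U = A + (L * U - A)"
      by (rule eq_matI) (use A sh in auto)
    ultimately show ?thesis using carr by blast
  qed
  then show ?thesis
    by (intro exI[of _ K] exI[of _ e] conjI e allI impI)
qed

end
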